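(* Let $d\ge1$, let $\phi:[0,1)^d\to\mathbb{R}$ be Lipschitz continuous with modulus $L>0$, i.e. $|\phi(\bm u)-\phi(\bm w)|\le L\|\bm u-\bm w\|_2$ for all $\bm u,\bm w\in[0,1)^d$. Let $X=\phi(\bm u)$ with $\bm u$ uniformly distributed on $[0,1)^d$, let $F$ be the cumulative distribution function of $X$, let $p\in(0,1)$ and $v=\inf\{x\in\mathbb{R}:F(x)\ge p\}$. Assume that $X$ has a density $f_X$ in a neighborhood of $v$ and that $f_X$ is positive and continuous at $v$. Let $b\ge2$ and $t\ge0$ be integers, and for $m\ge t$ let $N=b^m$ and let $\{\bm u_1,\dots,\bm u_N\}$ be a $(t,m,d)$-net in base $b$. Let $\hat F_N(x)=\frac1N\sum_{i=1}^N\bm 1\{\phi(\bm u_i)\le x\}$ and $\hat v_N=\inf\{x\in\mathbb{R}:\hat F_N(x)\ge p\}$. Then, for $N$ large enough, $$|\hat v_N-v|\le\frac{(10d+6f_X(v)L)\sqrt d\,b^{1+t/d}}{f_X(v)}\,N^{-1/d}.$$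
   Context: "$X$ has a density $f_X$ in a neighborhood of $v$" means that on some open interval $J\ni v$ one has $F(y)-F(x)=\int_x^y f_X(s)\,ds$ for $x<y$ in $J$. An elementary interval in base $b$ is a set $\prod_{j=1}^d\big[t_jb^{-k_j},(t_j+1)b^{-k_j}\big)$ with integers $k_j\ge0$ and $0\le t_j<b^{k_j}$; its volume is $b^{-\sum_j k_j}$. For integers $0\le t\le m$, a $(t,m,d)$-net in base $b$ is a set of $b^m$ points (counted with multiplicity) in $[0,1)^d$ such that every elementary interval in base $b$ of volume $b^{t-m}$ contains exactly $b^t$ of the points. *)

theory Defs
  imports "HOL-Probability.Probability"
begin

definition unit_cube :: "(real ^ 'n) set" where
  "unit_cube = {x. \<forall>j. 0 \<le> x $ j \<and> x $ j < 1}"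

text \<open>
  The underlying space is cut down to the cube, so that a function given on \<open>[0,1)\<^sup>d\<close> is a random
  variable regardless of the values of its HOL extension outside the cube.
\<close>
definition uniform_cube :: "(real ^ 'n) measure" where
  "uniform_cube = restrict_space (uniform_measure lborel unit_cube) unit_cube"

definition quantile :: "(real \<Rightarrow> real) \<Rightarrow> real \<Rightarrow> real" where
  "quantile F p = Inf {x. F x \<ge> p}"

text \<open>
  The gauge integral is used; as \<open>has_integral\<close> it includes integrability, and it extends the
  Lebesgue integral. Only the values of \<open>f\<close> on \<open>J\<close> matter.
\<close>
definition has_density_near :: "(real \<Rightarrow> real) \<Rightarrow> (real \<Rightarrow> real) \<Rightarrow> real \<Rightarrow> bool" where
  "has_density_near F f v \<longleftrightarrow>
     (\<exists>J. open J \<and> is_interval J \<and> v \<in> J \<and>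
        (\<forall>x\<in>J. \<forall>y\<in>J. x < y \<longrightarrow> (f has_integral (F y - F x)) {x..y}))"

definition elementary_interval :: "nat \<Rightarrow> (real ^ 'n) set \<Rightarrow> bool" where
  "elementary_interval b E \<longleftrightarrow>
     (\<exists>(k :: 'n \<Rightarrow> nat) (a :: 'n \<Rightarrow> nat). (\<forall>j. a j < b ^ k j) \<and>
        E = {x. \<forall>j. real (a j) / real b ^ k j \<le> x $ j \<and> x $ j < (real (a j) + 1) / real b ^ k j})"

text \<open>
  The points are the family \<open>u 1, \<dots>, u (b ^ m)\<close>, so they are counted with multiplicity; the
  dimension \<open>d\<close> is \<open>CARD('n)\<close>.
\<close>
definition tm_net :: "nat \<Rightarrow> nat \<Rightarrow> nat \<Rightarrow> (nat \<Rightarrow> real ^ 'n) \<Rightarrow> bool" where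
  "tm_net b t m u \<longleftrightarrow>
     t \<le> m \<and> (\<forall>i\<in>{1..b ^ m}. u i \<in> unit_cube) \<and>
     (\<forall>E. elementary_interval b E \<and> measure lborel E = real b powi (int t - int m) \<longrightarrow>
        card {i \<in> {1..b ^ m}. u i \<in> E} = b ^ t)"

definition empirical_cdf :: "nat \<Rightarrow> (nat \<Rightarrow> real) \<Rightarrow> real \<Rightarrow> real" where
  "empirical_cdf N X x = (1 / real N) * (\<Sum>i=1..N. of_bool (X i \<le> x))"

end

theory Submission
  imports Defs
begin

text \<open>
  Split the cube into elementary intervals of volume \<open>b\<^sup>t\<^sup>-\<^sup>m\<close> whose side exponents differ by at most
  one. Their diameter is at most \<open>\<delta> = \<surd>d \<cdot> b\<^sup>1\<^sup>+\<^sup>t\<^sup>/\<^sup>d \<cdot> N\<^sup>-\<^sup>1\<^sup>/\<^sup>d\<close>, so \<open>\<phi>\<close> oscillates by at most \<open>L\<delta>\<close> on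
  each of them. The uniform and the empirical distribution give every cell the same mass, hence
  \<open>F(x) \<le> G(x + L\<delta>)\<close> and \<open>G(x) \<le> F(x + L\<delta>)\<close> for the empirical distribution function \<open>G\<close>. This shifts
  every quantile by at most \<open>L\<delta>\<close>, which is below the claimed bound for every \<open>N\<close>.
\<close>

section \<open>Comparison of distribution functions and of their quantiles\<close>

text \<open>The cells that meet \<open>{\<phi> \<le> x}\<close> cover it, and their union has the
  same mass under both measures. By the oscillation bound this union stays inside
  \<open>{\<phi> \<le> x + \<eta>}\<close>. Only the \<sigma>-algebra is shared, so the two measures
  may later be exchanged.\<close>

lemma measure_sublevel_le_of_equal_on_partition:
  fixes \<phi> :: "'a \<Rightarrow> real"
  assumes fin: "finite_measure M" "finite_measure M'"
    and sets: "sets M' = sets M"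
    and meas: "\<phi> \<in> borel_measurable M"
    and I: "finite I" "disjoint_family_on C I" "\<And>a. a \<in> I \<Longrightarrow> C a \<in> sets M"
    and cover: "space M \<subseteq> (\<Union>a\<in>I. C a)"
    and eq: "\<And>a. a \<in> I \<Longrightarrow> measure M (C a) = measure M' (C a)"
    and osc: "\<And>a x y. a \<in> I \<Longrightarrow> x \<in> C a \<Longrightarrow> y \<in> C a \<Longrightarrow> \<phi> y \<le> \<phi> x + \<eta>"
  shows "measure M {w \<in> space M. \<phi> w \<le> x} \<le> measure M' {w \<in> space M'. \<phi> w \<le> x + \<eta>}"
proof -
  interpret M: finite_measure M by fact
  interpret M': finite_measure M' by fact
  have space: "space M' = space M"
    using sets by (rule sets_eq_imp_space_eq)
  define S where "S = {a \<in> I. \<exists>w\<in>C a. \<phi> w \<le> x}"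
  have S: "finite S" "S \<subseteq> I" "disjoint_family_on C S"
    using I by (auto simp: S_def disjoint_family_on_def)
  have sub: "C ` S \<subseteq> sets M" "C ` S \<subseteq> sets M'"
    using S I sets by auto
  have "measure M {w \<in> space M. \<phi> w \<le> x} \<le> measure M (\<Union>a\<in>S. C a)"
  proof (rule M.finite_measure_mono)
    show "{w \<in> space M. \<phi> w \<le> x} \<subseteq> (\<Union>a\<in>S. C a)"
      using cover by (fastforce simp: S_def)
    show "(\<Union>a\<in>S. C a) \<in> sets M" using S sub by blast
  qed
  also have "\<dots> = (\<Sum>a\<in>S. measure M (C a))"
    using S sub by (intro M.finite_measure_finite_Union) auto
  also have "\<dots> = (\<Sum>a\<in>S. measure M' (C a))"
    using S eq by (intro sum.cong) auto
  also have "\<dots> = measure M' (\<Union>a\<in>S. C a)"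
    using S sub by (intro M'.finite_measure_finite_Union[symmetric]) auto
  also have "\<dots> \<le> measure M' {w \<in> space M'. \<phi> w \<le> x + \<eta>}"
  proof (rule M'.finite_measure_mono)
    show "(\<Union>a\<in>S. C a) \<subseteq> {w \<in> space M'. \<phi> w \<le> x + \<eta>}"
    proof
      fix y assume "y \<in> (\<Union>a\<in>S. C a)"
      then obtain a w where a: "a \<in> I" "w \<in> C a" "\<phi> w \<le> x" "y \<in> C a"
        by (auto simp: S_def)
      moreover have "y \<in> space M"
        using a I(3) sets.sets_into_space by blast
      ultimately show "y \<in> {w \<in> space M'. \<phi> w \<le> x + \<eta>}"
        using osc[of a w y] space by auto
    qed
    have "{w \<in> space M. \<phi> w \<le> x + \<eta>} \<in> sets M"
      using meas by measurable
    then show "{w \<in> space M'. \<phi> w \<le> x + \<eta>} \<in> sets M'"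
      by (simp add: sets space)
  qed
  finally show ?thesis .
qed

text \<open>Translation by \<eta> maps the superlevel set of \<open>F\<close> into that of
  \<open>G\<close>. The last two assumptions ensure that both infima are genuine: on the reals
  \<open>Inf\<close> says nothing useful about empty or unbounded sets.\<close>

lemma quantile_le_shift:
  assumes "\<And>x. F x \<le> G (x + \<eta>)"
    and "{x. F x \<ge> p} \<noteq> {}" and "bdd_below {x. G x \<ge> p}"
  shows "quantile G p \<le> quantile F p + \<eta>"
proof -
  have "quantile G p - \<eta> \<le> quantile F p"
    unfolding quantile_def
  proof (rule cInf_greatest)
    fix x assume "x \<in> {x. F x \<ge> p}"
    then have "x + \<eta> \<in> {x. G x \<ge> p}"
      using assms(1)[of x] by auto
    then have "Inf {x. G x \<ge> p} \<le> x + \<eta>"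
      using assms(3) by (rule cInf_lower)
    then show "Inf {x. G x \<ge> p} - \<eta> \<le> x" by simp
  qed fact
  then show ?thesis by simp
qed

text \<open>Regularity is asked of \<open>F\<close> only: the shift inequalities carry nonemptiness
  and the lower bound over to the superlevel set of \<open>G\<close>, at the cost of \<eta>.\<close>

lemma abs_quantile_diff_le:
  assumes FG: "\<And>x. F x \<le> G (x + \<eta>)" and GF: "\<And>x. G x \<le> F (x + \<eta>)"
    and ne: "{x. F x \<ge> p} \<noteq> {}" and bdd: "bdd_below {x. F x \<ge> p}"
  shows "\<bar>quantile G p - quantile F p\<bar> \<le> \<eta>"
proof -
  obtain x where "F x \<ge> p" using ne by auto
  then have ne': "{x. G x \<ge> p} \<noteq> {}"
    using FG[of x] by (auto intro!: exI[of _ "x + \<eta>"])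
  obtain B where B: "\<And>x. F x \<ge> p \<Longrightarrow> B \<le> x"
    using bdd by (auto simp: bdd_below_def)
  have "bdd_below {x. G x \<ge> p}"
  proof (rule bdd_belowI)
    fix x assume "x \<in> {x. G x \<ge> p}"
    then show "B - \<eta> \<le> x"
      using B[of "x + \<eta>"] GF[of x] by auto
  qed
  then show ?thesis
    using quantile_le_shift[of F G \<eta> p] quantile_le_shift[of G F \<eta> p] FG GF ne ne' bdd by auto
qed

text \<open>Since \<open>p\<close> lies strictly between the limits 0 and 1 of the distribution
  function, the quantile is the infimum of a nonempty set that is bounded below.\<close>

lemma (in real_distribution) superlevel_cdf_nonempty_bdd_below:
  assumes "0 < p" "p < 1"
  shows "{x. cdf M x \<ge> p} \<noteq> {}" "bdd_below {x. cdf M x \<ge> p}"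
proof -
  have "eventually (\<lambda>x. p < cdf M x) at_top"
    using cdf_lim_at_top_prob assms(2) by (rule order_tendstoD(1))
  then obtain x where "p < cdf M x"
    by (auto simp: eventually_at_top_linorder)
  then show "{x. cdf M x \<ge> p} \<noteq> {}"
    using less_imp_le by blast
  have "eventually (\<lambda>x. cdf M x < p) at_bot"
    using cdf_lim_at_bot assms(1) by (rule order_tendstoD(2))
  then obtain B where B: "\<And>x. x \<le> B \<Longrightarrow> cdf M x < p"
    by (auto simp: eventually_at_bot_linorder)
  show "bdd_below {x. cdf M x \<ge> p}"
    using B by (intro bdd_belowI[of _ B]) (metis linear mem_Collect_eq not_le)
qed

section \<open>Boxes and the uniform distribution on the cube\<close>

text \<open>The half-open box lies between the open and the closed box with the same corners, whose
  volumes agree.\<close>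

lemma half_open_box_lborel:
  fixes l r :: "real ^ 'n"
  assumes "\<And>j. l $ j \<le> r $ j"
  shows "{x. \<forall>j. l $ j \<le> x $ j \<and> x $ j < r $ j} \<in> sets lborel"
    and "measure lborel {x. \<forall>j. l $ j \<le> x $ j \<and> x $ j < r $ j} = (\<Prod>j\<in>UNIV. r $ j - l $ j)"
    and "emeasure lborel {x. \<forall>j. l $ j \<le> x $ j \<and> x $ j < r $ j} < \<infinity>"
proof -
  let ?E = "{x. \<forall>j. l $ j \<le> x $ j \<and> x $ j < r $ j}"
  show E: "?E \<in> sets lborel" by measurable
  have sub: "box l r \<subseteq> ?E" "?E \<subseteq> cbox l r"
    by (auto simp: mem_box_cart less_imp_le)
  have fin: "emeasure lborel (cbox l r) < \<infinity>"
    by (simp add: emeasure_lborel_cbox_eq)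
  have le: "emeasure lborel ?E \<le> emeasure lborel (cbox l r)"
    using sub by (intro emeasure_mono) auto
  with fin show finE: "emeasure lborel ?E < \<infinity>" by order
  have "measure lborel ?E \<le> measure lborel (cbox l r)"
    using sub fin E by (intro measure_mono_fmeasurable) (auto simp: fmeasurable_def)
  moreover have "measure lborel (box l r) \<le> measure lborel ?E"
    using sub finE E by (intro measure_mono_fmeasurable) (auto simp: fmeasurable_def)
  moreover have "measure lborel (box l r) = measure lborel (cbox l r)"
    by (simp add: measure_lborel_box_eq measure_lborel_cbox_eq)
  moreover have "measure lborel (cbox l r) = (\<Prod>j\<in>UNIV. r $ j - l $ j)"
    using assms by (intro content_cbox_cart) (auto simp: interval_ne_empty_cart)
  ultimately show "measure lborel ?E = (\<Prod>j\<in>UNIV. r $ j - l $ j)" by simp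
qed

lemma sets_unit_cube: "(unit_cube :: (real ^ 'n) set) \<in> sets lborel"
  and measure_unit_cube: "measure lborel (unit_cube :: (real ^ 'n) set) = 1"
  and emeasure_unit_cube: "emeasure lborel (unit_cube :: (real ^ 'n) set) = 1"
proof -
  have eq: "(unit_cube :: (real ^ 'n) set) = {x. \<forall>j. (0 :: real ^ 'n) $ j \<le> x $ j \<and> x $ j < (1 :: real ^ 'n) $ j}"
    by (simp add: unit_cube_def)
  note box = half_open_box_lborel[of "0 :: real ^ 'n" 1, folded eq]
  show "(unit_cube :: (real ^ 'n) set) \<in> sets lborel" "measure lborel (unit_cube :: (real ^ 'n) set) = 1"
    using box by auto
  then show "emeasure lborel (unit_cube :: (real ^ 'n) set) = 1"
    using box(3) by (subst emeasure_eq_ennreal_measure) auto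
qed

lemma space_uniform_cube: "space uniform_cube = unit_cube"
  by (simp add: uniform_cube_def space_restrict_space)

lemma sets_uniform_cube_iff:
  "A \<in> sets (uniform_cube :: (real ^ 'n) measure) \<longleftrightarrow> A \<subseteq> unit_cube \<and> A \<in> sets lborel"
  using sets_unit_cube[where 'n='n]
  by (auto simp: uniform_cube_def sets_restrict_space_iff)

lemma measure_uniform_cube:
  fixes A :: "(real ^ 'n) set"
  assumes "A \<in> sets uniform_cube"
  shows "measure uniform_cube A = measure lborel A"
proof -
  have A: "A \<subseteq> unit_cube" "A \<in> sets lborel"
    using assms by (auto simp: sets_uniform_cube_iff)
  have "measure uniform_cube A = measure (uniform_measure lborel unit_cube) A"
    unfolding uniform_cube_def using A sets_unit_cube[where 'n='n]
    by (intro measure_restrict_space) auto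
  also have "\<dots> = measure lborel (unit_cube \<inter> A) / measure lborel (unit_cube :: (real ^ 'n) set)"
    using A sets_unit_cube[where 'n='n] emeasure_unit_cube[where 'n='n]
    by (intro measure_uniform_measure) auto
  finally show ?thesis
    using A by (simp add: measure_unit_cube Int_absorb1)
qed

lemma prob_space_uniform_cube: "prob_space (uniform_cube :: (real ^ 'n) measure)"
proof
  have "emeasure uniform_cube (unit_cube :: (real ^ 'n) set)
      = emeasure (uniform_measure lborel unit_cube) (unit_cube :: (real ^ 'n) set)"
    unfolding uniform_cube_def using sets_unit_cube[where 'n='n]
    by (intro emeasure_restrict_space) auto
  also have "\<dots> = 1"
    using sets_unit_cube[where 'n='n] emeasure_unit_cube[where 'n='n] by simp
  finally show "emeasure uniform_cube (space (uniform_cube :: (real ^ 'n) measure)) = 1"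
    by (simp add: space_uniform_cube)
qed

text \<open>Continuity on the cube suffices because the \<sigma>-algebra of
  \<open>uniform_cube\<close> is the trace of the Borel sets on the cube.\<close>

lemma continuous_on_measurable_uniform_cube:
  fixes \<phi> :: "real ^ 'n \<Rightarrow> real"
  assumes "continuous_on unit_cube \<phi>"
  shows "\<phi> \<in> borel_measurable uniform_cube"
proof -
  have "sets (uniform_cube :: (real ^ 'n) measure) = sets (restrict_space borel unit_cube)"
    unfolding uniform_cube_def by (rule sets_restrict_space_cong) simp
  then show ?thesis
    using borel_measurable_continuous_on_restrict[OF assms] measurable_cong_sets by blast
qed

section \<open>Partition of the cube into elementary intervals\<close>

text \<open>With \<open>a\<close> as a parameter, the elementary intervals of one fixed shape
  \<open>k\<close> form an indexed family that can serve as a partition.\<close>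

definition cell :: "nat \<Rightarrow> ('n \<Rightarrow> nat) \<Rightarrow> ('n \<Rightarrow> nat) \<Rightarrow> (real ^ 'n) set" where
  "cell b k a = {x. \<forall>j. real (a j) / real b ^ k j \<le> x $ j \<and> x $ j < (real (a j) + 1) / real b ^ k j}"

lemma cell_lborel:
  fixes a k :: "'n::finite \<Rightarrow> nat"
  assumes "b \<ge> 1"
  shows "cell b k a \<in> sets lborel"
    and "measure lborel (cell b k a) = 1 / real b ^ (\<Sum>j\<in>UNIV. k j)"
proof -
  define l r :: "real ^ 'n" where
    "l = (\<chi> j. real (a j) / real b ^ k j)" and "r = (\<chi> j. (real (a j) + 1) / real b ^ k j)"
  have eq: "cell b k a = {x. \<forall>j. l $ j \<le> x $ j \<and> x $ j < r $ j}"
    by (simp add: cell_def l_def r_def)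
  have le: "l $ j \<le> r $ j" for j
    by (auto simp: l_def r_def intro!: divide_right_mono)
  show "cell b k a \<in> sets lborel"
    unfolding eq using le by (rule half_open_box_lborel)
  have "measure lborel (cell b k a) = (\<Prod>j\<in>UNIV. 1 / real b ^ k j)"
    unfolding eq using half_open_box_lborel(2)[OF le]
    by (simp add: l_def r_def diff_divide_distrib[symmetric])
  also have "\<dots> = 1 / real b ^ (\<Sum>j\<in>UNIV. k j)"
    by (simp add: prod_dividef power_sum)
  finally show "measure lborel (cell b k a) = 1 / real b ^ (\<Sum>j\<in>UNIV. k j)" .
qed

text \<open>The cells are the fibres of the map that takes the integer parts of the rescaled
  coordinates. Both covering and disjointness follow from this.\<close>

lemma mem_cell_iff:
  assumes "b \<ge> 1"
  shows "x \<in> cell b k a \<longleftrightarrow> (\<forall>j. \<lfloor>real b ^ k j * x $ j\<rfloor> = int (a j))"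
proof -
  have "real b ^ k j > 0" for j using assms by simp
  then show ?thesis
    by (simp add: cell_def floor_eq_iff field_simps)
qed

lemma cell_subset_unit_cube:
  assumes "\<And>j. a j < b ^ k j"
  shows "cell b k a \<subseteq> unit_cube"
proof
  fix x assume x: "x \<in> cell b k a"
  have "0 \<le> x $ j \<and> x $ j < 1" for j
  proof -
    have "real (a j) / real b ^ k j \<le> x $ j" "x $ j < (real (a j) + 1) / real b ^ k j"
      using x by (auto simp: cell_def)
    \<comment> \<open>Integrality of \<open>a j < b ^ k j\<close> leaves room for the full side of
      the cell.\<close>
    moreover have "real (a j) + 1 \<le> real b ^ k j"
      using assms[of j] by (metis Suc_leI of_nat_Suc of_nat_le_iff of_nat_power add.commute)
    then have "(real (a j) + 1) / real b ^ k j \<le> 1"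
      by (subst divide_le_eq_1_pos) linarith+
    moreover have "0 \<le> real (a j) / real b ^ k j" by simp
    ultimately show ?thesis by linarith
  qed
  then show "x \<in> unit_cube" by (simp add: unit_cube_def)
qed

lemma unit_cube_subset_cells:
  fixes k :: "'n::finite \<Rightarrow> nat"
  assumes "b \<ge> 1"
  shows "unit_cube \<subseteq> (\<Union>a\<in>{a. \<forall>j. a j < b ^ k j}. cell b k a)"
proof
  fix x :: "real ^ 'n" assume x: "x \<in> unit_cube"
  \<comment> \<open>Coordinates in the cube are nonnegative, so \<open>nat\<close> does not truncate
    here.\<close>
  define a where "a j = nat \<lfloor>real b ^ k j * x $ j\<rfloor>" for j
  have b: "real b ^ k j > 0" for j using assms by simp
  have x0: "0 \<le> x $ j" "x $ j < 1" for j
    using x by (auto simp: unit_cube_def)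
  have "a j < b ^ k j" for j
  proof -
    have "real b ^ k j * x $ j < real b ^ k j"
      using b x0(2) by simp
    then have "\<lfloor>real b ^ k j * x $ j\<rfloor> < int (b ^ k j)"
      by (simp add: floor_less_iff)
    then show ?thesis
      using x0(1)[of j] b[of j] by (simp add: a_def nat_less_iff)
  qed
  moreover have "x \<in> cell b k a"
    using assms x0 by (simp add: mem_cell_iff a_def)
  ultimately show "x \<in> (\<Union>a\<in>{a. \<forall>j. a j < b ^ k j}. cell b k a)" by blast
qed

lemma disjoint_family_cell:
  assumes "b \<ge> 1"
  shows "disjoint_family (cell b k)"
  unfolding disjoint_family_on_def using mem_cell_iff[OF assms, of _ k]
  by (auto simp: set_eq_iff fun_eq_iff)

lemma finite_cell_indices: "finite {a :: 'n::finite \<Rightarrow> nat. \<forall>j. a j < f j}"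
proof -
  have "{a. \<forall>j. a j < f j} = (\<Pi>\<^sub>E j\<in>UNIV. {..<f j})"
    by (auto simp: PiE_def Pi_def)
  then show ?thesis by (simp add: finite_PiE)
qed

text \<open>Each coordinate difference is at most the longest possible side
  \<open>1 / b ^ K\<close>, and the Euclidean norm of a constant vector contributes the root of the
  dimension.\<close>

lemma dist_cell_le:
  fixes x y :: "real ^ 'n"
  assumes "b \<ge> 1" and "\<And>j. K \<le> k j" and "x \<in> cell b k a" "y \<in> cell b k a"
  shows "dist x y \<le> sqrt (real CARD('n)) / real b ^ K"
proof -
  have "norm (x $ j - y $ j) \<le> 1 / real b ^ K" for j
  proof -
    have "real (a j) / real b ^ k j \<le> x $ j" "x $ j < (real (a j) + 1) / real b ^ k j"
      "real (a j) / real b ^ k j \<le> y $ j" "y $ j < (real (a j) + 1) / real b ^ k j"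
      using assms by (auto simp: cell_def)
    then have "\<bar>x $ j - y $ j\<bar> \<le> 1 / real b ^ k j"
      by (auto simp: add_divide_distrib)
    also have "\<dots> \<le> 1 / real b ^ K"
      using assms(1) assms(2)[of j] by (intro divide_left_mono power_increasing) auto
    finally show ?thesis by simp
  qed
  then have "dist x y \<le> L2_set (\<lambda>j. 1 / real b ^ K) (UNIV :: 'n set)"
    by (auto simp: dist_norm norm_vec_def intro!: L2_set_mono)
  then show ?thesis
    by (simp add: L2_set_constant)
qed

text \<open>Every coordinate receives the quotient, and the remainder is spread as one extra unit
  over a set \<open>J\<close> of \<open>q mod CARD('n)\<close> coordinates. The sum fixes the volume
  of the cells, the lower bound limits their diameter.\<close>

lemma balanced_exponents:
  obtains k :: "'n::finite \<Rightarrow> nat"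
  where "(\<Sum>j\<in>UNIV. k j) = q" and "\<And>j. q div CARD('n) \<le> k j"
proof -
  have "q mod CARD('n) \<le> CARD('n)"
    by (simp add: less_imp_le)
  then obtain J :: "'n set" where J: "card J = q mod CARD('n)"
    by (metis obtain_subset_with_card_n)
  let ?k = "\<lambda>j. q div CARD('n) + of_bool (j \<in> J)"
  have "(\<Sum>j\<in>UNIV. ?k j) = CARD('n) * (q div CARD('n)) + card J"
    by (simp add: sum.distrib of_bool_def sum.If_cases)
  then show ?thesis
    using J by (intro that[of ?k]) auto
qed

section \<open>The empirical measure of a net\<close>

text \<open>Points of \<open>u\<close> outside the cube would make the underlying map non-measurable.\<close>

definition empirical_measure :: "nat \<Rightarrow> (nat \<Rightarrow> real ^ 'n) \<Rightarrow> (real ^ 'n) measure" where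
  "empirical_measure N u = distr (uniform_count_measure {1..N}) uniform_cube u"

text \<open>The push-forward from the index set counts repeated points with multiplicity, as
  \<open>tm_net\<close> does.\<close>

lemma empirical_measure:
  assumes "N \<ge> 1" and "\<forall>i\<in>{1..N}. u i \<in> unit_cube"
  shows "finite_measure (empirical_measure N u)"
    and "A \<in> sets uniform_cube \<Longrightarrow>
      measure (empirical_measure N u) A = real (card {i \<in> {1..N}. u i \<in> A}) / real N"
proof -
  have u: "u \<in> measurable (uniform_count_measure {1..N}) uniform_cube"
    using assms by (auto simp: measurable_def space_uniform_count_measure
        sets_uniform_count_measure space_uniform_cube)
  have "prob_space (uniform_count_measure {1..N})"
    using assms by (intro prob_space_uniform_count_measure) auto
  then show "finite_measure (empirical_measure N u)"
    using u unfolding empirical_measure_def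
    by (intro prob_space.finite_measure prob_space.prob_space_distr)
  assume A: "A \<in> sets uniform_cube"
  have "measure (empirical_measure N u) A
      = measure (uniform_count_measure {1..N}) (u -` A \<inter> {1..N})"
    using u A by (simp add: empirical_measure_def measure_distr space_uniform_count_measure)
  also have "\<dots> = real (card (u -` A \<inter> {1..N})) / real N"
    by (subst measure_uniform_count_measure) auto
  also have "u -` A \<inter> {1..N} = {i \<in> {1..N}. u i \<in> A}" by auto
  finally show "measure (empirical_measure N u) A = real (card {i \<in> {1..N}. u i \<in> A}) / real N" .
qed

text \<open>The net puts \<open>b ^ t\<close> of its \<open>b ^ m\<close> points into the cell, and
  this proportion is exactly the volume of the cell.\<close>

lemma tm_net_cell_measure:
  fixes u :: "nat \<Rightarrow> real ^ 'n"
  assumes b: "b \<ge> 1" and net: "tm_net b t m u"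
    and k: "(\<Sum>j\<in>UNIV. k j) = m - t" and a: "\<And>j. a j < b ^ k j"
  shows "measure (empirical_measure (b ^ m) u) (cell b k a) = measure uniform_cube (cell b k a)"
proof -
  have tm: "t \<le> m" and u: "\<forall>i\<in>{1..b ^ m}. u i \<in> unit_cube"
    using net by (auto simp: tm_net_def)
  have sets: "cell b k a \<in> sets uniform_cube"
    using cell_lborel(1)[OF b] cell_subset_unit_cube[of a b k] a
    by (simp add: sets_uniform_cube_iff)
  have vol: "measure lborel (cell b k a) = 1 / real b ^ (m - t)"
    by (simp add: cell_lborel(2)[OF b] k)
  \<comment> \<open>As \<open>t \<le> m\<close>, the integer exponent is nonpositive and
    \<open>powi\<close> is the reciprocal of a natural power.\<close>
  also have "\<dots> = real b powi (int t - int m)"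
    using tm by (simp add: power_int_def inverse_eq_divide power_one_over nat_diff_distrib')
  finally have "card {i \<in> {1..b ^ m}. u i \<in> cell b k a} = b ^ t"
    using net a unfolding tm_net_def elementary_interval_def cell_def by blast
  then have "measure (empirical_measure (b ^ m) u) (cell b k a) = real b ^ t / real b ^ m"
    using b u sets by (subst empirical_measure) auto
  also have "\<dots> = 1 / real b ^ (m - t)"
    using b tm by (simp add: power_diff field_simps)
  finally show ?thesis
    using vol sets by (simp add: measure_uniform_cube)
qed

lemma cdf_distr_eq:
  assumes "\<phi> \<in> borel_measurable M"
  shows "cdf (distr M borel \<phi>) x = measure M {w \<in> space M. \<phi> w \<le> x}"
  using assms by (auto simp: cdf_def measure_distr intro!: arg_cong[of _ _ "measure M"])

lemma tm_net_quantile_error: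
  fixes u :: "nat \<Rightarrow> real ^ 'n" and \<phi> :: "real ^ 'n \<Rightarrow> real"
  assumes lip: "L-lipschitz_on unit_cube \<phi>"
    and p: "0 < p" "p < 1" and b: "b \<ge> 1" and net: "tm_net b t m u"
  shows "\<bar>quantile (empirical_cdf (b ^ m) (\<lambda>i. \<phi> (u i))) p - quantile (cdf (distr uniform_cube borel \<phi>)) p\<bar>
    \<le> L * (sqrt (real CARD('n)) / real b ^ ((m - t) div CARD('n)))"
proof -
  define N where "N = b ^ m"
  define F where "F = cdf (distr uniform_cube borel \<phi>)"
  define G where "G = empirical_cdf N (\<lambda>i. \<phi> (u i))"
  obtain k :: "'n \<Rightarrow> nat" where k: "(\<Sum>j\<in>UNIV. k j) = m - t" "\<And>j. (m - t) div CARD('n) \<le> k j"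
    using balanced_exponents[where 'n='n] by metis
  \<comment> \<open>The Lipschitz constant times the diameter bound of
    \<open>dist_cell_le\<close>.\<close>
  define \<eta> where "\<eta> = L * (sqrt (real CARD('n)) / real b ^ ((m - t) div CARD('n)))"
  define I where "I = {a. \<forall>j. a j < b ^ k j}"
  define U where "U = (uniform_cube :: (real ^ 'n) measure)"
  define E where "E = empirical_measure N u"
  have N: "N \<ge> 1" using b by (simp add: N_def)
  have u: "\<forall>i\<in>{1..N}. u i \<in> unit_cube"
    using net by (auto simp: tm_net_def N_def)
  interpret U: prob_space U
    unfolding U_def by (rule prob_space_uniform_cube)
  have \<phi>: "\<phi> \<in> borel_measurable U"
    unfolding U_def using lipschitz_on_continuous_on[OF lip]
    by (rule continuous_on_measurable_uniform_cube)
  have setsE: "sets E = sets U"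
    by (simp add: E_def U_def empirical_measure_def)
  have spaceE: "space E = space U"
    using setsE by (rule sets_eq_imp_space_eq)
  have finE: "finite_measure E"
    using N u by (simp add: E_def empirical_measure)
  have cells: "finite I" "disjoint_family_on (cell b k) I" "space U \<subseteq> (\<Union>a\<in>I. cell b k a)"
    using finite_cell_indices[of "\<lambda>j. b ^ k j"] disjoint_family_cell[OF b, of k]
      unit_cube_subset_cells[OF b, of k]
    by (auto simp: I_def U_def space_uniform_cube disjoint_family_on_def)
  have cell_sets: "cell b k a \<in> sets U" if "a \<in> I" for a
    using that cell_lborel(1)[OF b] cell_subset_unit_cube[of a b k]
    by (simp add: U_def I_def sets_uniform_cube_iff)
  have eq: "measure E (cell b k a) = measure U (cell b k a)" if "a \<in> I" for a
    using that unfolding E_def U_def N_def I_def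
    by (intro tm_net_cell_measure[OF b net k(1)]) auto
  have osc: "\<phi> y \<le> \<phi> x + \<eta>" if "a \<in> I" "x \<in> cell b k a" "y \<in> cell b k a" for a x y
  proof -
    have "x \<in> unit_cube" "y \<in> unit_cube"
      using that cell_subset_unit_cube[of a b k] by (auto simp: I_def)
    then have "dist (\<phi> y) (\<phi> x) \<le> L * dist y x"
      using lip by (auto intro: lipschitz_onD)
    also have "\<dots> \<le> \<eta>"
      unfolding \<eta>_def using that k(2) b lipschitz_on_nonneg[OF lip]
      by (intro mult_left_mono dist_cell_le) auto
    finally show ?thesis by (simp add: dist_real_def)
  qed
  have F: "F x = measure U {w \<in> space U. \<phi> w \<le> x}" for x
    using \<phi> by (simp add: F_def U_def cdf_distr_eq)
  \<comment> \<open>This rewrites the empirical distribution function as sublevel masses of a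
    measure on the \<sigma>-algebra of \<open>U\<close>, the form the partition lemma
    requires.\<close>
  have G: "G x = measure E {w \<in> space E. \<phi> w \<le> x}" for x
  proof -
    let ?A = "{w \<in> space U. \<phi> w \<le> x}"
    have "?A \<in> sets uniform_cube"
      using \<phi> unfolding U_def by measurable
    then have "measure E ?A = real (card {i \<in> {1..N}. u i \<in> ?A}) / real N"
      unfolding E_def using N u by (intro empirical_measure)
    also have "{i \<in> {1..N}. u i \<in> ?A} = {i \<in> {1..N}. \<phi> (u i) \<le> x}"
      using u by (auto simp: U_def space_uniform_cube)
    also have "real (card \<dots>) = (\<Sum>i=1..N. of_bool (\<phi> (u i) \<le> x))"
      by (simp add: of_bool_def sum.If_cases Int_def)
    finally show ?thesis
      by (simp add: G_def empirical_cdf_def spaceE)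
  qed
  have "F x \<le> G (x + \<eta>)" for x
    unfolding F G
    by (rule measure_sublevel_le_of_equal_on_partition[where I = I and C = "cell b k"])
      (use U.finite_measure_axioms finE setsE \<phi> cells cell_sets eq osc in auto)
  \<comment> \<open>The same argument with the measures exchanged; measurability of \<phi> passes
    from \<open>U\<close> to \<open>E\<close> along \<open>setsE\<close>.\<close>
  moreover have "G x \<le> F (x + \<eta>)" for x
    unfolding F G
    by (rule measure_sublevel_le_of_equal_on_partition[where I = I and C = "cell b k"])
      (use U.finite_measure_axioms finE setsE \<phi> cells cell_sets eq osc spaceE
        measurable_cong_sets[OF setsE refl] in auto)
  moreover have "real_distribution (distr U borel \<phi>)"
    using \<phi> by (rule U.real_distribution_distr)
  then have "{x. F x \<ge> p} \<noteq> {}" "bdd_below {x. F x \<ge> p}"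
    using real_distribution.superlevel_cdf_nonempty_bdd_below p by (auto simp: F_def U_def)
  ultimately have "\<bar>quantile G p - quantile F p\<bar> \<le> \<eta>"
    by (rule abs_quantile_diff_le)
  then show ?thesis
    by (simp add: F_def G_def N_def \<eta>_def)
qed

section \<open>The convergence rate and the final bound\<close>

text \<open>Rounding \<open>(m - t) / d\<close> down loses less than 1 in the exponent. This loss is
  the summand 1 in \<open>1 + t / d\<close>.\<close>

lemma inverse_power_div_le_powr:
  assumes "b \<ge> 2" "d \<ge> 1" "t \<le> m"
  shows "1 / real b ^ ((m - t) div d) \<le> real b powr (1 + real t / real d) * real (b ^ m) powr (- 1 / real d)"
proof -
  let ?K = "(m - t) div d"
  have "m - t < d * (?K + 1)"
    using assms by (metis Suc_eq_plus1 dividend_less_times_div mult_Suc_right add.commute less_le_trans zero_less_one)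
  then have "real m - real t \<le> real d * (real ?K + 1)"
    using assms by (metis less_imp_le of_nat_le_iff of_nat_mult of_nat_diff of_nat_Suc Suc_eq_plus1 add.commute)
  then have "(real m - real t) / real d \<le> real ?K + 1"
    using assms by (simp add: pos_divide_le_eq mult.commute)
  then have exps: "- real ?K \<le> 1 + real t / real d + real m * (- 1 / real d)"
    by (simp add: diff_divide_distrib)
  have "1 / real b ^ ?K = real b powr (- real ?K)"
    using assms by (simp add: powr_minus powr_realpow inverse_eq_divide)
  also have "\<dots> \<le> real b powr (1 + real t / real d + real m * (- 1 / real d))"
    using exps assms by (intro powr_mono) auto
  also have "\<dots> = real b powr (1 + real t / real d) * (real b powr real m) powr (- 1 / real d)"
    by (simp only: powr_add powr_powr)
  also have "real b powr real m = real (b ^ m)"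
    using assms by (simp add: powr_realpow)
  finally show ?thesis .
qed

theorem theorem3p8:
  fixes \<phi> :: "real ^ 'n \<Rightarrow> real" and F f :: "real \<Rightarrow> real" and L p v :: real and b t d :: nat
  assumes "d = CARD('n)"
    and "L > 0" and "L-lipschitz_on unit_cube \<phi>"
    and "F = cdf (distr uniform_cube borel \<phi>)"
    and "0 < p" and "p < 1"
    and "v = quantile F p"
    and "has_density_near F f v" and "f v > 0" and "isCont f v"
    and "b \<ge> 2"
  shows "\<exists>N\<^sub>0 :: nat. \<forall>m N u. m \<ge> t \<longrightarrow> N = b ^ m \<longrightarrow> N \<ge> N\<^sub>0 \<longrightarrow> tm_net b t m (u :: nat \<Rightarrow> real ^ 'n) \<longrightarrow>
           \<bar>quantile (empirical_cdf N (\<lambda>i. \<phi> (u i))) p - v\<bar>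
             \<le> ((10 * real d + 6 * f v * L) * sqrt (real d) * real b powr (1 + real t / real d)) / f v
                * real N powr (- 1 / real d)"
\<comment> \<open>The estimate below holds for every \<open>N = b ^ m\<close> with
  \<open>m \<ge> t\<close>, so 0 serves as the threshold.\<close>
proof (intro exI[of _ 0] allI impI)
  fix m N :: nat and u :: "nat \<Rightarrow> real ^ 'n"
  assume tm: "m \<ge> t" and N: "N = b ^ m" and net: "tm_net b t m u"
  let ?B = "real b powr (1 + real t / real d)" and ?R = "real N powr (- 1 / real d)"
  have d: "d \<ge> 1" using assms(1) by (simp add: Suc_leI)
  have "\<bar>quantile (empirical_cdf N (\<lambda>i. \<phi> (u i))) p - v\<bar> \<le> L * (sqrt (real d) / real b ^ ((m - t) div d))"
    using tm_net_quantile_error[OF assms(3,5,6) _ net] assms by (simp add: N)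
  also have "\<dots> = (L * sqrt (real d)) * (1 / real b ^ ((m - t) div d))" by simp
  also have "\<dots> \<le> (L * sqrt (real d)) * (?B * ?R)"
    using inverse_power_div_le_powr[OF assms(11) d tm] assms(2) unfolding N
    by (intro mult_left_mono) auto
  also have "\<dots> = L * (sqrt (real d) * (?B * ?R))" by simp
  \<comment> \<open>Since \<open>f v > 0\<close>, the new factor equals
    \<open>10 * d / f v + 6 * L\<close>, which is at least \<open>L\<close>.\<close>
  also have "\<dots> \<le> (10 * real d + 6 * f v * L) / f v * (sqrt (real d) * (?B * ?R))"
    using assms(2,9) by (intro mult_right_mono) (auto simp: field_simps)
  also have "\<dots> = ((10 * real d + 6 * f v * L) * sqrt (real d) * ?B) / f v * ?R" by simp
  finally show "\<bar>quantile (empirical_cdf N (\<lambda>i. \<phi> (u i))) p - v\<bar>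
      \<le> ((10 * real d + 6 * f v * L) * sqrt (real d) * ?B) / f v * ?R" .
qed

end
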